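(* Let $G_{L,3}(q)$ be as in the context, and write $S(q)\succeq 0$ to mean all coefficients of the power series $S(q)$ are nonnegative. Then: For $L \ge 10$: $G_{L,3}(q)+q^4+q^5+q^8+q^{10}+q^{12}+q^{14}+q^{16} \succeq 0$. $G_{9,3}(q)+q^4+q^5+q^8+q^{10}+q^{12}+q^{14}+2q^{16} \succeq 0$. $G_{8,3}(q)+q^4+q^5+q^8+q^{10}+q^{12}+q^{14}+2q^{16}+q^{20} \succeq 0$. $G_{7,3}(q)+q^4+q^5+q^8+q^{10}+q^{12}+2q^{14}+q^{16}+q^{20} \succeq 0$. $G_{6,3}(q)+q^4+q^5+q^8+q^{10}+q^{12}+q^{13}+2q^{14}+2q^{16}+q^{18}+2q^{20}+q^{22} \succeq 0$. $G_{5,3}(q)+q^4+q^5+q^8+q^{10}+2q^{12}+q^{13}+q^{14}+2q^{16}+q^{17}+q^{18}+3q^{20}+q^{22}+q^{24}+q^{28} \succeq 0$. $G_{4,3}(q)+q^4+q^5+q^8+q^{10}+q^{11}+2q^{12}+2q^{14}+3q^{16}+q^{17}+2q^{18}+q^{19}+4q^{20}+3q^{22}+q^{23}+4q^{24}+q^{25}+4q^{26}+5q^{28}+q^{29}+3q^{30}+6q^{32}+3q^{34}+4q^{36}+2q^{38}+4q^{40}+2q^{44} \succeq 0$.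
   Context: A partition $\pi$ is a finite weakly decreasing sequence of positive integers; $|\pi|$ is the sum of its parts, $s(\pi)$ its smallest part and $l(\pi)$ its largest part. For positive integers $L,s$, $$G_{L,s}(q) := \sum_{\substack{\pi \text{ nonempty},\ s(\pi)=s,\\ l(\pi)-s(\pi)\le L}} q^{|\pi|} \;-\; \sum_{\substack{\pi \text{ nonempty},\ s(\pi)\ge s+1,\\ l(\pi)-s(\pi)\le L}} q^{|\pi|}.$$ *)

theory Defs
  imports "HOL-Computational_Algebra.Formal_Power_Series"
begin

definition is_partition :: "nat list \<Rightarrow> bool" where
  "is_partition p \<longleftrightarrow> sorted_wrt (\<ge>) p \<and> (\<forall>x\<in>set p. 0 < x)"

text \<open>The size of a partition is \<^const>\<open>sum_list\<close>. The next two notions are only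
  meaningful for nonempty partitions.\<close>

definition smallest_part :: "nat list \<Rightarrow> nat" where
  "smallest_part p = Min (set p)"

definition largest_part :: "nat list \<Rightarrow> nat" where
  "largest_part p = Max (set p)"

text \<open>The generating function of a set \<open>P\<close> of partitions, i.e. the sum of
  \<open>q\<close> to the power of the size over \<open>P\<close>. The cardinalities are meaningful by the
  finiteness lemma that follows.\<close>

definition partition_gf :: "nat list set \<Rightarrow> int fps" where
  "partition_gf P = Abs_fps (\<lambda>n. int (card {p \<in> P. sum_list p = n}))"

lemma finite_partitions_of_size: "finite {p. is_partition p \<and> sum_list p = n}"
proof (rule finite_subset)
  show "{p. is_partition p \<and> sum_list p = n} \<subseteq> {p. set p \<subseteq> {..n} \<and> length p \<le> n}"
  proof safe
    fix p :: "nat list" and x assume "x \<in> set p"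
    then show "x \<le> sum_list p" by (simp add: member_le_sum_list)
  next
    fix p :: "nat list" assume "is_partition p"
    then have "\<forall>x\<in>set p. 0 < x" by (simp add: is_partition_def)
    then show "length p \<le> sum_list p" by (induction p) auto
  qed
  show "finite {p. set p \<subseteq> {..n} \<and> length p \<le> n}"
    by (rule finite_lists_length_le) simp
qed

definition G :: "nat \<Rightarrow> nat \<Rightarrow> int fps" where
  "G L s =
     partition_gf {p. is_partition p \<and> p \<noteq> [] \<and> smallest_part p = s \<and>
                      largest_part p - smallest_part p \<le> L} -
     partition_gf {p. is_partition p \<and> p \<noteq> [] \<and> smallest_part p \<ge> s + 1 \<and>
                      largest_part p - smallest_part p \<le> L}"

definition fps_nonneg :: "int fps \<Rightarrow> bool" where
  "fps_nonneg S \<longleftrightarrow> (\<forall>n. fps_nth S n \<ge> 0)"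

end

theory Submission
  imports Defs
begin

text \<open>
  Sorting by smallest part and telescoping gives
  \<open>G\<^bsub>L,s\<^esub> = (q\<^sup>s/(1 - q\<^sup>s) - 1/(1 - q\<^sup>L)) P + 1/(1 - q\<^sup>L)\<close> with
  \<open>P = 1/((1 - q\<^bsup>s+1\<^esup>) \<dots> (1 - q\<^bsup>s+L\<^esup>))\<close>. For \<open>L = 3u + c\<close> with
  \<open>u > 0\<close> and \<open>c\<close> one of 0, 4, 5, cutting the two geometric series off after
  corresponding terms only decreases the product with \<open>P\<close>, because
  \<open>(q\<^bsup>3ut\<^esup> - q\<^bsup>Lt\<^esup>)/(1 - q\<^sup>c)\<close> has nonnegative coefficients. So it suffices
  to look at a polynomial times a product of factors \<open>1/(1 - q\<^sup>a)\<close>.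

  Nonnegativity of such a series is a finite computation: if \<open>f = g/(1 - q\<^sup>a)\<close>, where \<open>g\<close>
  has nonnegative coefficients from index \<open>N\<close> on and the last \<open>a\<close> coefficients of \<open>f\<close> before
  index \<open>N\<close> are at least \<open>d\<close>, then so are all later ones. This settles each \<open>L \<le> 23\<close>; for
  \<open>L \<in> {4, 5, 7, 8}\<close> the difference of the two geometric series is rewritten exactly instead.

  For \<open>L \<ge> 24\<close> a single computation with the factors \<open>4 \<le> i \<le> 13\<close> serves all \<open>L\<close>. The product
  \<open>R\<close> of the remaining factors satisfies \<open>R \<le> 1 + q\<^bsup>14\<^esup>/(1 - q) R\<close> coefficientwise, so the
  effect of \<open>R\<close> on the finitely many negative coefficients is outweighed by the positive ones.
\<close>

unbundle fps_syntax

subsection \<open>Generating functions\<close>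

text \<open>The series 1/(1 - q^a) for positive \<open>a\<close>, given by its coefficients so that
  it exists over the integers. The value \<open>geo 0\<close> is 1.\<close>

definition geo :: "nat \<Rightarrow> int fps" where
  "geo a = Abs_fps (\<lambda>n. if a dvd n then 1 else 0)"

lemma geo_inverse: "0 < a \<Longrightarrow> (1 - fps_X ^ a) * geo a = 1"
  by (rule fps_ext)
    (auto simp: geo_def left_diff_distrib fps_X_power_mult_nth dvd_minus_self dest: dvd_imp_le)

text \<open>Multiplying the hypothesis by \<open>geo a\<close> cancels 1 - q^a. Recurrences (1 -
  q^a) f = g are solved in this way.\<close>

lemma geo_unique:
  assumes "0 < a" "(1 - fps_X ^ a) * f = g"
  shows "f = g * geo a"
proof -
  have "g * geo a = (1 - fps_X ^ a) * geo a * f"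
    unfolding assms(2)[symmetric] by (simp only: mult_ac)
  then show ?thesis
    by (simp only: geo_inverse[OF assms(1)] mult_1)
qed

text \<open>A weakly decreasing list is determined by its multiset of entries. Counting multisets
  instead makes adding or removing a part independent of its position.\<close>

lemma card_partitions_mset:
  "card {p. is_partition p \<and> P (mset p)} = card {M. 0 \<notin># M \<and> P M}"
proof (rule bij_betw_same_card[of mset], rule bij_betwI')
  fix p q :: "nat list"
  assume "p \<in> {p. is_partition p \<and> P (mset p)}" "q \<in> {p. is_partition p \<and> P (mset p)}"
  then have "sorted (rev p)" "sorted (rev q)"
    by (auto simp: is_partition_def sorted_wrt_rev)
  then show "(mset p = mset q) = (p = q)"
    by (metis mset_rev properties_for_sort rev_is_rev_conv)
next
  fix M :: "nat multiset" assume M: "M \<in> {M. 0 \<notin># M \<and> P M}"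
  show "\<exists>p\<in>{p. is_partition p \<and> P (mset p)}. M = mset p"
  proof (rule bexI[of _ "rev (sorted_list_of_multiset M)"])
    show "rev (sorted_list_of_multiset M) \<in> {p. is_partition p \<and> P (mset p)}"
      using M by (auto simp: is_partition_def sorted_wrt_rev intro!: gr0I)
  qed simp
qed (auto simp: is_partition_def)

section \<open>Partitions with parts from a prescribed set\<close>

definition partitions_in :: "nat set \<Rightarrow> nat list set" where
  "partitions_in A = {p. is_partition p \<and> set p \<subseteq> A}"

text \<open>Removing one copy of \<open>s\<close> is a bijection onto all partitions with parts in
  \<open>A\<close>, and lowers the size by \<open>s\<close>.\<close>

lemma partition_gf_with_part:
  assumes "s \<in> A" "0 < s"
  shows "partition_gf {p \<in> partitions_in A. s \<in> set p} = fps_X ^ s * partition_gf (partitions_in A)"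
proof (rule fps_ext)
  fix n
  define T where "T n = {M. 0 \<notin># M \<and> set_mset M \<subseteq> A \<and> sum_mset M = n}" for n
  have T: "card {p \<in> partitions_in A. sum_list p = n} = card (T n)" for n
    using card_partitions_mset[of "\<lambda>M. set_mset M \<subseteq> A \<and> sum_mset M = n"]
    by (simp add: partitions_in_def T_def sum_mset_sum_list conj_assoc)
  have "card {p \<in> {p \<in> partitions_in A. s \<in> set p}. sum_list p = n}
      = card {M. 0 \<notin># M \<and> s \<in># M \<and> set_mset M \<subseteq> A \<and> sum_mset M = n}"
    using card_partitions_mset[of "\<lambda>M. s \<in># M \<and> set_mset M \<subseteq> A \<and> sum_mset M = n"]
    by (simp add: partitions_in_def sum_mset_sum_list conj_assoc conj_commute conj_left_commute)
  also have "{M. 0 \<notin># M \<and> s \<in># M \<and> set_mset M \<subseteq> A \<and> sum_mset M = n}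
      = (if n < s then {} else add_mset s ` T (n - s))" (is "?U = ?V")
  proof (rule set_eqI, rule iffI)
    fix M assume "M \<in> ?U"
    moreover from this obtain M' where "M = add_mset s M'"
      by (metis (mono_tags, lifting) mem_Collect_eq mset_add)
    ultimately show "M \<in> ?V"
      by (auto simp: T_def)
  next
    fix M assume "M \<in> ?V"
    then show "M \<in> ?U"
      using assms by (auto simp: T_def split: if_splits)
  qed
  finally show "partition_gf {p \<in> partitions_in A. s \<in> set p} $ n
      = (fps_X ^ s * partition_gf (partitions_in A)) $ n"
    by (auto simp: partition_gf_def fps_X_power_mult_nth T card_image inj_on_def)
qed

lemma partition_gf_Un:
  assumes "P \<inter> Q = {}" "P \<union> Q \<subseteq> Collect is_partition"
  shows "partition_gf (P \<union> Q) = partition_gf P + partition_gf Q"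
proof (rule fps_ext)
  fix n
  have fin: "finite {p \<in> R. sum_list p = n}" if "R \<subseteq> Collect is_partition" for R
    using that by (auto intro: finite_subset[OF _ finite_partitions_of_size[of n]])
  have "{p \<in> P \<union> Q. sum_list p = n} = {p \<in> P. sum_list p = n} \<union> {p \<in> Q. sum_list p = n}"
    by auto
  then show "partition_gf (P \<union> Q) $ n = (partition_gf P + partition_gf Q) $ n"
    using assms fin[of P] fin[of Q]
    by (simp add: partition_gf_def) (subst card_Un_disjoint, auto)
qed

text \<open>Adjoining a new part \<open>a\<close> changes the generating function from g to f with f
  = g + q^a f, according to whether \<open>a\<close> occurs.\<close>

lemma partition_gf_partitions_in:
  assumes "finite A" "0 \<notin> A"
  shows "partition_gf (partitions_in A) = (\<Prod>a\<in>A. geo a)"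
  using assms
proof (induction A rule: finite_induct)
  case empty
  have "{p \<in> partitions_in {}. sum_list p = n} = (if n = 0 then {[]} else {})" for n
    by (auto simp: partitions_in_def is_partition_def)
  then show ?case
    by (intro fps_ext) (simp add: partition_gf_def)
next
  case (insert a A)
  have "partitions_in (insert a A) = partitions_in A \<union> {p \<in> partitions_in (insert a A). a \<in> set p}"
    by (auto simp: partitions_in_def)
  moreover have "partition_gf (partitions_in A \<union> {p \<in> partitions_in (insert a A). a \<in> set p})
      = partition_gf (partitions_in A) + partition_gf {p \<in> partitions_in (insert a A). a \<in> set p}"
    using insert.hyps by (intro partition_gf_Un) (auto simp: partitions_in_def)
  ultimately have "partition_gf (partitions_in (insert a A))
      = partition_gf (partitions_in A) + fps_X ^ a * partition_gf (partitions_in (insert a A))"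
    using insert.prems by (simp add: partition_gf_with_part)
  then have "(1 - fps_X ^ a) * partition_gf (partitions_in (insert a A)) = partition_gf (partitions_in A)"
    by (simp add: algebra_simps)
  from geo_unique[OF _ this] show ?case
    using insert by (simp add: mult.commute)
qed

section \<open>Sorting partitions by their smallest part\<close>

lemma partitions_smallest:
  "{p. is_partition p \<and> p \<noteq> [] \<and> smallest_part p = s \<and> largest_part p - smallest_part p \<le> L}
    = {p \<in> partitions_in {s..s+L}. s \<in> set p}"
proof (intro set_eqI iffI; clarify)
  fix p assume p: "is_partition p" "p \<noteq> []" "s = smallest_part p"
    "largest_part p - smallest_part p \<le> L"
  have "smallest_part p \<le> x \<and> x \<le> largest_part p" if "x \<in> set p" for x
    using that by (simp add: smallest_part_def largest_part_def)
  then have "smallest_part p \<le> x \<and> x \<le> smallest_part p + L" if "x \<in> set p" for x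
    using that p(4) by fastforce
  moreover have "smallest_part p \<in> set p"
    using p(2) by (simp add: smallest_part_def)
  ultimately show "p \<in> partitions_in {smallest_part p..smallest_part p + L} \<and> smallest_part p \<in> set p"
    using p(1) by (auto simp: partitions_in_def)
next
  fix p assume p: "p \<in> partitions_in {s..s+L}" "s \<in> set p"
  then have "smallest_part p = s"
    unfolding smallest_part_def partitions_in_def by (intro Min_eqI) auto
  moreover have "largest_part p \<le> s + L"
    using p unfolding largest_part_def partitions_in_def by (subst Max_le_iff) auto
  ultimately show "is_partition p \<and> p \<noteq> [] \<and> smallest_part p = s \<and>
      largest_part p - smallest_part p \<le> L"
    using p by (auto simp: partitions_in_def)
qed

lemma partition_gf_smallest:
  assumes "0 < s"
  shows "partition_gf {p. is_partition p \<and> p \<noteq> [] \<and> smallest_part p = s \<and>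
      largest_part p - smallest_part p \<le> L} = fps_X ^ s * (\<Prod>i\<in>{s..s+L}. geo i)"
  unfolding partitions_smallest
  using partition_gf_with_part[of s "{s..s+L}"] partition_gf_partitions_in[of "{s..s+L}"] assms
  by simp

text \<open>The two products on the right share all factors but \<open>geo n\<close> and
  \<open>geo (n+L)\<close>, and (1 - q^(n+L)) - (1 - q^n) = q^n (1 - q^L).\<close>

lemma prod_geo_telescope:
  assumes "0 < n" "0 < L"
  shows "(1 - fps_X ^ L) * (fps_X ^ n * (\<Prod>i\<in>{n..n+L}. geo i))
    = (\<Prod>i\<in>{n..<n+L}. geo i) - (\<Prod>i\<in>{Suc n..<Suc n+L}. geo i)"
proof -
  define R where "R = (\<Prod>i\<in>{Suc n..<n+L}. geo i)"
  have "{n..n+L} = insert n (insert (n+L) {Suc n..<n+L})" "{n..<n+L} = insert n {Suc n..<n+L}"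
    "{Suc n..<Suc n+L} = insert (n+L) {Suc n..<n+L}"
    using assms by auto
  then have *: "(\<Prod>i\<in>{n..n+L}. geo i) = geo n * (geo (n+L) * R)"
    "(\<Prod>i\<in>{n..<n+L}. geo i) = geo n * R"
    "(\<Prod>i\<in>{Suc n..<Suc n+L}. geo i) = geo (n+L) * R"
    using assms by (simp_all add: R_def)
  have "(1 - fps_X ^ n) * geo n = 1" "(1 - fps_X ^ (n + L)) * geo (n + L) = 1"
    using assms by (simp_all only: geo_inverse add_pos_pos)
  then have "geo n * R - geo (n+L) * R
      = geo n * ((1 - fps_X ^ (n + L)) * geo (n + L)) * R - ((1 - fps_X ^ n) * geo n) * geo (n+L) * R"
    by (simp only: mult_1 mult_1_right)
  also have "\<dots> = (1 - fps_X ^ L) * (fps_X ^ n * (geo n * (geo (n+L) * R)))"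
    by (simp only: algebra_simps power_add mult_1)
  finally show ?thesis
    by (simp only: *)
qed

lemma prod_geo_nth_small:
  assumes "m < k"
  shows "(\<Prod>i\<in>{k..<k+L}. geo i) $ m = (if m = 0 then 1 else 0)"
proof -
  have "{p \<in> partitions_in {k..<k+L}. sum_list p = m} = (if m = 0 then {[]} else {})"
  proof -
    have "p = []" if "p \<in> partitions_in {k..<k+L}" "sum_list p = m" for p
    proof (cases p)
      case (Cons x xs)
      then show ?thesis using that assms by (auto simp: partitions_in_def)
    qed
    moreover have "sum_list [] = (0::nat)" "[] \<in> partitions_in {k..<k+L}"
      by (simp_all add: partitions_in_def is_partition_def)
    ultimately show ?thesis 
      by (intro set_eqI) (metis (mono_tags, lifting) empty_iff mem_Collect_eq singleton_iff)
  qed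
  then show ?thesis
    using assms by (subst partition_gf_partitions_in[symmetric]) (auto simp: partition_gf_def)
qed

text \<open>Summing over the smallest part telescopes after multiplication by 1 - q^L. Coefficients
  are compared one at a time: for q^m the sum may stop before \<open>s + m\<close>, where the
  leftover product agrees with 1 up to q^m.\<close>

lemma partition_gf_smallest_ge:
  assumes "0 < s" "0 < L"
  shows "partition_gf {p. is_partition p \<and> p \<noteq> [] \<and> smallest_part p \<ge> s \<and>
      largest_part p - smallest_part p \<le> L} = ((\<Prod>i\<in>{s..<s+L}. geo i) - 1) * geo L"
    (is "partition_gf ?S = _")
proof (rule geo_unique[OF \<open>0 < L\<close>], rule fps_ext)
  define H where "H n = {p. is_partition p \<and> p \<noteq> [] \<and> smallest_part p = n \<and>
      largest_part p - smallest_part p \<le> L}" for n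
  fix m
  have nth: "partition_gf ?S $ k = (\<Sum>n=s..<s+m. partition_gf (H n)) $ k" if "k \<le> m" for k
  proof -
    have "{p \<in> ?S. sum_list p = k} = (\<Union>n\<in>{s..<s+m}. {p \<in> H n. sum_list p = k})"
    proof -
      have "smallest_part p \<le> sum_list p" if "p \<noteq> []" for p
        using that by (simp add: smallest_part_def member_le_sum_list)
      then have "smallest_part p < s + m"
        if "p \<noteq> []" "sum_list p = k" for p
        using \<open>k \<le> m\<close> that \<open>0 < s\<close> by fastforce
      then show ?thesis by (auto simp: H_def)
    qed
    moreover have "finite {p \<in> H n. sum_list p = k}" for n
      by (auto simp: H_def intro: finite_subset[OF _ finite_partitions_of_size[of k]])
    ultimately have "card {p \<in> ?S. sum_list p = k} = (\<Sum>n\<in>{s..<s+m}. card {p \<in> H n. sum_list p = k})"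
      by (simp add: card_UN_disjoint H_def disjoint_iff)
    then show ?thesis
      by (simp add: partition_gf_def fps_sum_nth)
  qed
  have "(1 - fps_X ^ L) * (\<Sum>n=s..<s+m. partition_gf (H n))
      = (\<Sum>n=s..<s+m. (\<Prod>i\<in>{n..<n+L}. geo i) - (\<Prod>i\<in>{Suc n..<Suc n+L}. geo i))"
    unfolding sum_distrib_left
  proof (rule sum.cong[OF refl])
    fix n assume "n \<in> {s..<s+m}"
    then have "0 < n" using assms by simp
    then show "(1 - fps_X ^ L) * partition_gf (H n)
        = (\<Prod>i\<in>{n..<n+L}. geo i) - (\<Prod>i\<in>{Suc n..<Suc n+L}. geo i)"
      unfolding H_def by (simp only: partition_gf_smallest prod_geo_telescope[OF _ assms(2)])
  qed
  also have "\<dots> = (\<Prod>i\<in>{s..<s+L}. geo i) - (\<Prod>i\<in>{s+m..<s+m+L}. geo i)"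
    by (induction m) simp_all
  finally have *: "(1 - fps_X ^ L) * (\<Sum>n=s..<s+m. partition_gf (H n))
      = (\<Prod>i\<in>{s..<s+L}. geo i) - (\<Prod>i\<in>{s+m..<s+m+L}. geo i)" .
  have "((1 - fps_X ^ L) * partition_gf ?S) $ m
      = ((1 - fps_X ^ L) * (\<Sum>n=s..<s+m. partition_gf (H n))) $ m"
    using nth by (simp add: left_diff_distrib fps_X_power_mult_nth)
  also have "\<dots> = ((\<Prod>i\<in>{s..<s+L}. geo i) - 1) $ m"
    unfolding * using prod_geo_nth_small[of m "s + m" L] assms by simp
  finally show "((1 - fps_X ^ L) * partition_gf ?S) $ m = ((\<Prod>i\<in>{s..<s+L}. geo i) - 1) $ m" .
qed

lemma G_eq:
  assumes "0 < s" "0 < L"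
  shows "G L s = (fps_X ^ s * geo s - geo L) * (\<Prod>i\<in>{s+1..s+L}. geo i) + geo L"
proof -
  have "{s..s+L} = insert s {s+1..s+L}"
    by auto
  then have "(\<Prod>i\<in>{s..s+L}. geo i) = geo s * (\<Prod>i\<in>{s+1..s+L}. geo i)"
    by simp
  moreover have "{s+1..<s+1+L} = {s+1..s+L}"
    by auto
  moreover have "0 < s + 1"
    by simp
  ultimately have "G L s = fps_X ^ s * (geo s * (\<Prod>i\<in>{s+1..s+L}. geo i))
      - ((\<Prod>i\<in>{s+1..s+L}. geo i) - 1) * geo L"
    unfolding G_def
    by (simp only: partition_gf_smallest[OF assms(1)] partition_gf_smallest_ge[OF _ assms(2)])
  then show ?thesis
    by (simp only: algebra_simps mult_1)
qed

subsection \<open>Certified lower bounds for coefficients\<close>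

text \<open>Symbolic expressions, so that bounds can be evaluated. \<open>Sparse\<close> lists
  exponents with coefficients, and \<open>Over\<close> divides by the product of the 1 -
  q^a.\<close>

datatype series =
  Sparse "(nat \<times> int) list" | Over series "nat list" | Plus series series

primrec denote :: "series \<Rightarrow> int fps" where
  "denote (Sparse ps) = (\<Sum>(e, c)\<leftarrow>ps. of_int c * fps_X ^ e)"
| "denote (Over s as) = denote s * (\<Prod>a\<leftarrow>as. geo a)"
| "denote (Plus s t) = denote s + denote t"

text \<open>An approximation \<open>(d, xs)\<close> lists an initial segment of coefficients and a lower bound for
  all the later ones.\<close>

definition bounds :: "int \<times> int list \<Rightarrow> int fps \<Rightarrow> bool" where
  "bounds c f \<longleftrightarrow> snd c = map (fps_nth f) [0..<length (snd c)] \<and> (\<forall>n\<ge>length (snd c). fst c \<le> f $ n)"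

text \<open>The length of \<open>buf\<close> is the exponent \<open>a\<close> of the divisor \<open>1 - q\<^sup>a\<close>; it holds the last
  \<open>a\<close> computed coefficients of the quotient.\<close>

fun divide_list :: "int list \<Rightarrow> int list \<Rightarrow> int list" where
  "divide_list buf [] = []"
| "divide_list buf (x # xs) = (let y = x + hd buf in y # divide_list (tl buf @ [y]) xs)"

text \<open>Division is refused unless the tail bound is nonnegative and the last \<open>a\<close>
  coefficients are available; their minimum is the new bound. So the order of the divisors
  matters.\<close>

fun divide_bounds :: "nat list \<Rightarrow> int \<times> int list \<Rightarrow> (int \<times> int list) option" where
  "divide_bounds [] c = Some c"
| "divide_bounds (a # as) c =
    (if fst c < 0 \<or> a = 0 \<or> length (snd c) < a then None
     else let ys = divide_list (replicate a 0) (snd c); t = take a (rev ys)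
          in divide_bounds as (fold min t (hd t), ys))"

definition add_bounds :: "int \<times> int list \<Rightarrow> int \<times> int list \<Rightarrow> int \<times> int list" where
  "add_bounds c d = (fst c + fst d, map2 (+) (snd c) (snd d))"

text \<open>Coefficients accumulate because exponents may repeat: a truncation contains +q^(sj) and
  -q^(Lt), possibly with sj = Lt.\<close>

definition sparse_list :: "nat \<Rightarrow> (nat \<times> int) list \<Rightarrow> int list" where
  "sparse_list N ps = fold (\<lambda>(e, c) xs. xs[e := xs ! e + c]) ps (replicate N 0)"

fun compute :: "nat \<Rightarrow> series \<Rightarrow> (int \<times> int list) option" where
  "compute N (Sparse ps) =
    (if list_all (\<lambda>(e, c). e < N) ps then Some (0, sparse_list N ps) else None)"
| "compute N (Over s as) = Option.bind (compute N s) (divide_bounds as)"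
| "compute N (Plus s t) =
    Option.bind (compute N s) (\<lambda>c. Option.bind (compute N t) (\<lambda>d. Some (add_bounds c d)))"

definition certified :: "nat \<Rightarrow> series \<Rightarrow> bool" where
  "certified N s = (case compute N s of None \<Rightarrow> False
     | Some (d, xs) \<Rightarrow> 0 \<le> d \<and> list_all (\<lambda>x. 0 \<le> x) xs)"

section \<open>Soundness of the computed bounds\<close>

lemma divide_list:
  assumes "0 < a"
  shows "divide_list (map f [m..<m+a]) (map (\<lambda>i. f (i + a) - f i) [m..<m+k]) = map f [m+a..<m+a+k]"
proof (induction k arbitrary: m)
  case (Suc k)
  \<comment> \<open>The buffer is a window of \<open>a\<close> consecutive values of
    \<open>f\<close>; each step drops \<open>f m\<close> and appends
    \<open>f (m + a)\<close>.\<close>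
  have "[m..<m + Suc k] = m # [Suc m..<Suc m + k]"
    "[m+a..<m+a+Suc k] = (m + a) # [Suc m+a..<Suc m+a+k]"
    "[m..<m+a] = m # [Suc m..<m+a]" "[Suc m..<Suc m+a] = [Suc m..<m+a] @ [m+a]"
    using assms by (simp_all add: upt_conv_Cons)
  then show ?case
    using Suc[of "Suc m"] by (simp add: Let_def)
qed simp

lemma divide_list_geo:
  assumes "0 < a" "g * geo a = f"
  shows "divide_list (replicate a 0) (map (fps_nth g) [0..<N]) = map (fps_nth f) [0..<N]"
proof -
  \<comment> \<open>The quotient shifted up by \<open>a\<close>: the leading zeros are its
    coefficients at negative indices and form the initial buffer.\<close>
  define h where "h i = (if i < a then 0 else f $ (i - a))" for i
  have "(1 - fps_X ^ a) * f = g * ((1 - fps_X ^ a) * geo a)"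
    by (simp only: assms(2)[symmetric] mult_ac)
  then have g: "g = f - fps_X ^ a * f"
    using geo_inverse[OF assms(1)] by (simp add: left_diff_distrib)
  have "divide_list (map h [0..<0+a]) (map (\<lambda>i. h (i + a) - h i) [0..<0+N]) = map h [0+a..<0+a+N]"
    by (rule divide_list[OF assms(1)])
  moreover have "map h [0..<0+a] = replicate a 0"
    by (rule nth_equalityI) (auto simp: h_def)
  moreover have "map (\<lambda>i. h (i + a) - h i) [0..<0+N] = map (fps_nth g) [0..<N]"
    by (auto simp: g h_def fps_X_power_mult_nth)
  moreover have "map h [0+a..<0+a+N] = map (fps_nth f) [0..<N]"
    by (rule nth_equalityI) (auto simp: h_def)
  ultimately show ?thesis by (simp only:)
qed

lemma fold_min_le: "fold min t (m::int) \<le> m \<and> (\<forall>x\<in>set t. fold min t m \<le> x)"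
proof (induction t arbitrary: m)
  case (Cons a t)
  from Cons[of "min a m"] show ?case by auto
qed simp

text \<open>Strong induction along f_n = g_n + f_(n-a), which leads back to the \<open>a\<close>
  coefficients just before \<open>N\<close>.\<close>

lemma geo_tail_bound:
  assumes "0 < a" "g * geo a = f" and g: "\<And>n. N \<le> n \<Longrightarrow> 0 \<le> g $ n"
    and f: "\<And>n. n < N \<Longrightarrow> N \<le> n + a \<Longrightarrow> d \<le> f $ n" and "a \<le> N"
  shows "N \<le> n \<Longrightarrow> d \<le> f $ n"
proof (induction n rule: less_induct)
  case (less n)
  have "(1 - fps_X ^ a) * f = g * ((1 - fps_X ^ a) * geo a)"
    by (simp only: assms(2)[symmetric] mult_ac)
  then have "g = f - fps_X ^ a * f"
    using geo_inverse[OF assms(1)] by (simp add: left_diff_distrib)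
  then have "f $ n = g $ n + f $ (n - a)"
    using less.prems \<open>a \<le> N\<close> by (simp add: fps_X_power_mult_nth)
  moreover have "d \<le> f $ (n - a)"
    using less assms by (cases "n - a < N") auto
  ultimately show ?case
    using g[OF less.prems] by simp
qed

lemma divide_bounds:
  "divide_bounds as c = Some c' \<Longrightarrow> bounds c f \<Longrightarrow>
    bounds c' (f * (\<Prod>a\<leftarrow>as. geo a)) \<and> length (snd c') = length (snd c)"
proof (induction as c arbitrary: f rule: divide_bounds.induct)
  case (2 a as c)
  define N where "N = length (snd c)"
  define ys where "ys = divide_list (replicate a 0) (snd c)"
  define d where "d = fold min (take a (rev ys)) (hd (take a (rev ys)))"
  have a: "0 \<le> fst c" "0 < a" "a \<le> N" and rest: "divide_bounds as (d, ys) = Some c'"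
    using "2.prems"(1) by (auto simp: Let_def N_def ys_def d_def split: if_splits)
  have ys: "ys = map (fps_nth (f * geo a)) [0..<N]"
    using "2.prems"(2) divide_list_geo[OF \<open>0 < a\<close> refl, of f N]
    by (simp add: bounds_def N_def ys_def)
  have "d \<le> (f * geo a) $ n" if "n < N" "N \<le> n + a" for n
  proof -
    have "rev ys ! (N - Suc n) = (f * geo a) $ n"
      using that by (simp add: ys rev_nth)
    moreover have "N - Suc n < a"
      using that by simp
    ultimately have "(f * geo a) $ n \<in> set (take a (rev ys))"
      using that a by (auto simp: in_set_conv_nth ys intro!: exI[of _ "N - Suc n"])
    then show ?thesis
      using fold_min_le by (auto simp: d_def)
  qed
  moreover have "0 \<le> f $ n" if "N \<le> n" for n
    using "2.prems"(2) a(1) that by (auto simp: bounds_def N_def intro: order_trans)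
  ultimately have "d \<le> (f * geo a) $ n" if "N \<le> n" for n
    using geo_tail_bound[OF a(2) refl _ _ a(3)] that by blast
  then have "bounds (d, ys) (f * geo a)"
    by (simp add: bounds_def ys)
  then show ?case
    using "2.IH"[OF _ ys_def refl, of "f * geo a"] rest a ys
    by (auto simp: N_def d_def mult.assoc)
qed simp

lemma bounds_add:
  assumes "bounds c f" "bounds d g" "length (snd c) = length (snd d)"
  shows "bounds (add_bounds c d) (f + g)"
proof -
  have "snd (add_bounds c d) = map (fps_nth (f + g)) [0..<length (snd c)]"
  proof (rule nth_equalityI)
    fix i assume "i < length (snd (add_bounds c d))"
    then have "i < length (snd c)" "i < length (snd d)"
      by (simp_all add: add_bounds_def)
    moreover from this have "snd c ! i = f $ i" "snd d ! i = g $ i"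
      using assms(1,2) unfolding bounds_def by (metis add_0 nth_map_upt diff_zero)+
    ultimately show "snd (add_bounds c d) ! i = map (fps_nth (f + g)) [0..<length (snd c)] ! i"
      by (simp add: add_bounds_def)
  qed (use assms(3) in \<open>simp add: add_bounds_def\<close>)
  then show ?thesis
    using assms by (auto simp: bounds_def add_bounds_def intro: add_mono)
qed

lemma sparse_list:
  assumes "list_all (\<lambda>(e, c). e < N) ps"
  shows "bounds (0, sparse_list N ps) (denote (Sparse ps)) \<and> length (sparse_list N ps) = N"
proof -
  have "bounds (0, fold (\<lambda>(e, c) xs. xs[e := xs ! e + c]) ps xs) (f + denote (Sparse ps))
      \<and> length (fold (\<lambda>(e, c) xs. xs[e := xs ! e + c]) ps xs) = N"
    if "bounds (0, xs) f" "length xs = N" for xs f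
    using assms that
  proof (induction ps arbitrary: xs f)
    case (Cons p ps)
    obtain e c where p: "p = (e, c)" by fastforce
    have nth: "(f + of_int c * fps_X ^ e) $ n = f $ n + (if n = e then c else 0)" for n
      by (simp add: fps_of_int[symmetric])
    have xs: "xs = map (fps_nth f) [0..<N]"
      using Cons.prems by (simp add: bounds_def)
    have "xs[e := xs ! e + c] = map (fps_nth (f + of_int c * fps_X ^ e)) [0..<N]"
      by (rule nth_equalityI) (auto simp: xs nth nth_list_update)
    moreover have "\<forall>n\<ge>N. 0 \<le> (f + of_int c * fps_X ^ e) $ n"
      using Cons.prems by (auto simp: p nth bounds_def)
    ultimately have "bounds (0, xs[e := xs ! e + c]) (f + of_int c * fps_X ^ e)"
      by (simp add: bounds_def)
    from Cons.IH[OF _ this] Cons.prems show ?case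
      by (simp add: p add.assoc)
  qed simp
  moreover have "bounds (0, replicate N 0) 0"
    by (auto simp: bounds_def intro: nth_equalityI)
  from calculation[OF this] show ?thesis
    by (simp add: sparse_list_def)
qed

lemma compute_bounds:
  "compute N s = Some c \<Longrightarrow> bounds c (denote s) \<and> length (snd c) = N"
proof (induction s arbitrary: c)
  case (Sparse ps)
  then show ?case using sparse_list[of N ps] by (auto split: if_splits simp del: denote.simps)
next
  case (Over s as)
  then show ?case by (auto simp: bind_eq_Some_conv dest: divide_bounds)
next
  case (Plus s t)
  then obtain c1 c2 where "compute N s = Some c1" "compute N t = Some c2" "c = add_bounds c1 c2"
    by (auto simp: bind_eq_Some_conv)
  with Plus.IH(1)[of c1] Plus.IH(2)[of c2] show ?case
    by (simp add: bounds_add) (simp add: add_bounds_def)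
qed

lemma certified_nonneg:
  assumes "certified N s"
  shows "fps_nonneg (denote s)"
proof -
  obtain d xs where c: "compute N s = Some (d, xs)" "0 \<le> d" "list_all (\<lambda>x. 0 \<le> x) xs"
    using assms by (auto simp: certified_def split: option.splits)
  have xs: "xs = map (fps_nth (denote s)) [0..<N]" and "\<forall>n\<ge>N. d \<le> denote s $ n"
    using compute_bounds[OF c(1)] by (auto simp: bounds_def)
  moreover have "0 \<le> denote s $ n" if "n < N" for n
    using c(3) that unfolding xs by (auto simp: list_all_iff)
  ultimately show ?thesis
    unfolding fps_nonneg_def using c(2) by (metis order_trans not_le)
qed

subsection \<open>Truncating the geometric series\<close>

lemma fps_nonneg_add: "fps_nonneg f \<Longrightarrow> fps_nonneg g \<Longrightarrow> fps_nonneg (f + g)"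
  by (simp add: fps_nonneg_def)

lemma fps_nonneg_mult: "fps_nonneg f \<Longrightarrow> fps_nonneg g \<Longrightarrow> fps_nonneg (f * g)"
  by (simp add: fps_nonneg_def fps_mult_nth sum_nonneg)

lemma fps_nonneg_sum: "(\<And>i. i \<in> A \<Longrightarrow> fps_nonneg (f i)) \<Longrightarrow> fps_nonneg (\<Sum>i\<in>A. f i)"
  by (simp add: fps_nonneg_def fps_sum_nth sum_nonneg)

lemma fps_nonneg_power_X: "fps_nonneg (fps_X ^ n)"
  by (simp add: fps_nonneg_def)

lemma fps_nonneg_geo: "fps_nonneg (geo a)"
  by (simp add: fps_nonneg_def geo_def)

lemma fps_nonneg_prod_geo: "fps_nonneg (\<Prod>i\<in>A. geo i)"
proof (induction A rule: infinite_finite_induct)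
  case (insert x F)
  then show ?case by (simp add: fps_nonneg_mult fps_nonneg_geo)
qed (simp_all add: fps_nonneg_def)

lemma geo_expand:
  assumes "0 < a"
  shows "geo a = (\<Sum>j<n. fps_X ^ (a * j)) + fps_X ^ (a * n) * geo a"
proof (induction n)
  case (Suc n)
  have "geo a = 1 + fps_X ^ a * geo a"
    using geo_inverse[OF assms] by (simp only: left_diff_distrib mult_1 diff_eq_eq)
  then have "fps_X ^ (a * n) * geo a = fps_X ^ (a * n) * (1 + fps_X ^ a * geo a)"
    by (simp only:)
  also have "\<dots> = fps_X ^ (a * n) + fps_X ^ (a * Suc n) * geo a"
    by (simp only: distrib_left mult_1 mult_1_right power_add mult_Suc_right mult_ac)
  finally have "(\<Sum>j<n. fps_X ^ (a * j)) + fps_X ^ (a * n) * geo a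
      = (\<Sum>j<Suc n. fps_X ^ (a * j)) + fps_X ^ (a * Suc n) * geo a"
    by (simp only: sum.lessThan_Suc add_ac)
  then show ?case
    using Suc by (simp only:)
qed simp

lemma geo_diff:
  assumes "0 < a"
  shows "geo a - geo (a + c) = (1 - fps_X ^ c) * (fps_X ^ a * (geo a * geo (a + c)))"
proof -
  have "geo a - geo (a + c)
      = geo a * ((1 - fps_X ^ (a + c)) * geo (a + c)) - ((1 - fps_X ^ a) * geo a) * geo (a + c)"
    using assms by (simp only: geo_inverse add_pos_nonneg mult_1 mult_1_right zero_le)
  also have "\<dots> = (1 - fps_X ^ c) * (fps_X ^ a * (geo a * geo (a + c)))"
    by (simp only: algebra_simps power_add mult_1)
  finally show ?thesis .
qed

text \<open>The factor 1 - q^c of \<open>geo_diff\<close> cancels, leaving a visibly nonnegative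
  series. Thus a part \<open>c\<close> compensates for replacing \<open>a\<close> by
  \<open>a + c\<close>.\<close>

lemma geo_diff_mult_geo:
  assumes "0 < a" "0 < c"
  shows "(geo a - geo (a + c)) * geo c = fps_X ^ a * (geo a * geo (a + c))"
proof -
  have "(geo a - geo (a + c)) * geo c
      = ((1 - fps_X ^ c) * geo c) * (fps_X ^ a * (geo a * geo (a + c)))"
    by (simp only: geo_diff[OF assms(1)] mult_ac)
  then show ?thesis
    by (simp only: geo_inverse[OF assms(2)] mult_1)
qed

text \<open>Initial terms of q^s/(1 - q^s) - 1/(1 - q^L): the numerator q^s makes \<open>j\<close>
  start at 1, whereas \<open>t\<close> starts at 0.\<close>

definition truncation :: "nat \<Rightarrow> nat \<Rightarrow> nat \<Rightarrow> nat \<Rightarrow> series" where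
  "truncation s J L T = Sparse (map (\<lambda>j. (s * j, 1)) [1..<J] @ map (\<lambda>t. (L * t, -1)) [0..<T])"

text \<open>Both tails are compared with that of \<open>geo (s * u)\<close> from q^(suT) on. Its
  exponents are multiples of \<open>s\<close> that are at least \<open>s * J\<close>, so the first
  tail dominates it; the factor \<open>geo c\<close> makes it dominate the second.\<close>

lemma geo_remainder_nonneg:
  assumes "0 < s" "0 < u" "L = s * u + c" "J \<le> u * T" "c = 0 \<or> c \<in> A" "finite A"
  shows "fps_nonneg ((fps_X ^ (s * J) * geo s - fps_X ^ (L * T) * geo L) * (\<Prod>i\<in>A. geo i))"
proof -
  define a where "a = s * u"
  have a: "0 < a" using assms by (simp add: a_def)
  have "fps_nonneg (fps_X ^ (s * J) * geo s - fps_X ^ (a * T) * geo a)"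
  proof -
    have "s * J \<le> a * T"
      using assms(4) by (simp add: a_def)
    moreover have "s dvd n - s * J" if "a dvd n - a * T" "a * T \<le> n" for n
    proof -
      have "s dvd n - a * T"
        using that(1) by (simp add: a_def dvd_mult_left)
      then have "s dvd (n - a * T) + a * T"
        by (simp add: a_def)
      then show ?thesis
        using that(2) by simp
    qed
    ultimately show ?thesis
      by (auto simp: fps_nonneg_def fps_X_power_mult_nth geo_def)
  qed
  then have 1: "fps_nonneg ((fps_X ^ (s * J) * geo s - fps_X ^ (a * T) * geo a) * (\<Prod>i\<in>A. geo i))"
    by (intro fps_nonneg_mult fps_nonneg_prod_geo)
  have 2: "fps_nonneg ((fps_X ^ (a * T) * geo a - fps_X ^ (L * T) * geo L) * (\<Prod>i\<in>A. geo i))"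
  proof (cases "c = 0")
    case True
    then show ?thesis using assms by (simp add: a_def fps_nonneg_def)
  next
    case False
    then have "(\<Prod>i\<in>A. geo i) = geo c * (\<Prod>i\<in>A - {c}. geo i)"
      using assms by (intro prod.remove) auto
    \<comment> \<open>As LT = aT + cT, the difference splits into a change of step from
      \<open>a\<close> to \<open>L\<close> and a change of starting point; \<open>geo c\<close>
      makes each nonnegative.\<close>
    moreover have "(fps_X ^ (a * T) * geo a - fps_X ^ (L * T) * geo L) * geo c
        = fps_X ^ (a * T) * ((geo a - geo L) * geo c)
          + fps_X ^ (a * T) * (geo c - fps_X ^ (c * T) * geo c) * geo L"
      by (simp only: assms(3) a_def algebra_simps power_add)
    moreover have "(geo a - geo L) * geo c = fps_X ^ a * (geo a * geo L)"
      using False geo_diff_mult_geo[OF a] assms(3) by (simp add: a_def)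
    moreover have "geo c - fps_X ^ (c * T) * geo c = (\<Sum>j<T. fps_X ^ (c * j))"
      using False geo_expand[of c T] by (simp only: diff_eq_eq)
    ultimately have "(fps_X ^ (a * T) * geo a - fps_X ^ (L * T) * geo L) * (\<Prod>i\<in>A. geo i)
        = (fps_X ^ (a * T) * (fps_X ^ a * (geo a * geo L))
          + fps_X ^ (a * T) * (\<Sum>j<T. fps_X ^ (c * j)) * geo L) * (\<Prod>i\<in>A - {c}. geo i)"
      by (metis mult.assoc)
    then show ?thesis
      by (auto intro!: fps_nonneg_mult fps_nonneg_add fps_nonneg_sum
          fps_nonneg_geo fps_nonneg_prod_geo fps_nonneg_power_X)
  qed
  have "(fps_X ^ (s * J) * geo s - fps_X ^ (L * T) * geo L) * (\<Prod>i\<in>A. geo i)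
      = (fps_X ^ (s * J) * geo s - fps_X ^ (a * T) * geo a) * (\<Prod>i\<in>A. geo i)
        + (fps_X ^ (a * T) * geo a - fps_X ^ (L * T) * geo L) * (\<Prod>i\<in>A. geo i)"
    by (simp only: algebra_simps)
  then show ?thesis
    using fps_nonneg_add[OF 1 2] by (simp only:)
qed

lemma truncation_remainder:
  assumes "0 < s" "0 < J" "0 < L"
  shows "fps_X ^ s * geo s - geo L
    = denote (truncation s J L T) + (fps_X ^ (s * J) * geo s - fps_X ^ (L * T) * geo L)"
proof -
  have "denote (truncation s J L T) = (\<Sum>j=1..<J. fps_X ^ (s * j)) - (\<Sum>t<T. fps_X ^ (L * t))"
    by (simp add: truncation_def comp_def interv_sum_list_conv_sum_set_nat sum_negf atLeast0LessThan)
  moreover have "(\<Sum>j<J. fps_X ^ (s * j)) = 1 + (\<Sum>j=1..<J. fps_X ^ (s * j) :: int fps)"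
    using assms(2) by (simp add: lessThan_atLeast0 sum.atLeast_Suc_lessThan)
  then have "(\<Sum>j=1..<J. fps_X ^ (s * j)) = (\<Sum>j<J. fps_X ^ (s * j)) - (1 :: int fps)"
    by (simp only: add_diff_cancel_left')
  moreover have "(\<Sum>j<J. fps_X ^ (s * j)) = geo s - fps_X ^ (s * J) * geo s"
    using geo_expand[OF assms(1)] by (simp only: eq_diff_eq)
  moreover have "(\<Sum>t<T. fps_X ^ (L * t)) = geo L - fps_X ^ (L * T) * geo L"
    using geo_expand[OF assms(3)] by (simp only: eq_diff_eq)
  moreover have "1 = geo s - fps_X ^ s * geo s"
    using geo_inverse[OF assms(1)] by (simp only: left_diff_distrib mult_1)
  ultimately have *: "denote (truncation s J L T) = geo s - fps_X ^ (s * J) * geo s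
      - (geo s - fps_X ^ s * geo s) - (geo L - fps_X ^ (L * T) * geo L)"
    by (simp only:)
  show ?thesis
    unfolding * by (simp only: algebra_simps add_diff_cancel_left)
qed

lemma denote_Over_distinct:
  "distinct as \<Longrightarrow> denote (Over s as) = denote s * (\<Prod>i\<in>set as. geo i)"
  by (simp add: prod.distinct_set_conv_list)

text \<open>The divisor \<open>a\<close> is moved to the front because it has to be divided out
  first. A nonzero \<open>c\<close> lies in 4..L+3, as \<open>geo_remainder_nonneg\<close>
  requires.\<close>

lemma G_nonneg_if_certified:
  assumes "L = 3 * u + c" "0 < u" "c = 0 \<or> 4 \<le> c" "0 < T" "4 \<le> a" "a \<le> L + 3"
    and cert: "certified N (Plus (Over (truncation 3 (u * T) L T) (a # remove1 a [4..<L+4]))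
      (Plus (Sparse E) (Over (Sparse [(0, 1)]) [L])))"
  shows "fps_nonneg (G L 3 + denote (Sparse E))"
proof -
  let ?P = "\<Prod>i\<in>{3+1..3+L}. geo i" and ?Q = "denote (truncation 3 (u * T) L T)"
    and ?D = "fps_X ^ (3 * (u * T)) * geo 3 - fps_X ^ (L * T) * geo L"
  have "set (a # remove1 a [4..<L+4]) = {3+1..3+L}" "distinct (a # remove1 a [4..<L+4])"
    using assms by auto
  then have "denote (Over (truncation 3 (u * T) L T) (a # remove1 a [4..<L+4])) = ?Q * ?P"
    by (simp only: denote_Over_distinct)
  moreover have "denote (Over (Sparse [(0, 1)]) [L]) = geo L"
    by simp
  ultimately have "fps_nonneg (?Q * ?P + (denote (Sparse E) + geo L))"
    using certified_nonneg[OF cert] by (simp only: denote.simps(3))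
  moreover have "fps_nonneg (?D * ?P)"
    using assms by (intro geo_remainder_nonneg) auto
  ultimately have "fps_nonneg ((?Q * ?P + (denote (Sparse E) + geo L)) + ?D * ?P)"
    by (rule fps_nonneg_add)
  also have "(?Q * ?P + (denote (Sparse E) + geo L)) + ?D * ?P
      = ((?Q + ?D) * ?P + geo L) + denote (Sparse E)"
    by (simp only: distrib_right add_ac)
  also have "?Q + ?D = fps_X ^ 3 * geo 3 - geo L"
    using assms by (intro truncation_remainder[symmetric]) auto
  also have "(fps_X ^ 3 * geo 3 - geo L) * ?P + geo L = G L 3"
    using assms by (intro G_eq[symmetric]) auto
  finally show ?thesis .
qed

subsection \<open>Nonnegativity of the corrected series\<close>

text \<open>With R the product, R - 1 counts nonempty partitions. Each arises by adding a part i in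
  \<open>A\<close> to another one, so R - 1 is at most R times the sum of the q^i, and that sum is
  at most q^k/(1 - q).\<close>

lemma prod_geo_tail:
  assumes "finite A" "\<And>i. i \<in> A \<Longrightarrow> k \<le> i" "0 < k"
  shows "fps_nonneg (1 + fps_X ^ k * geo 1 * (\<Prod>i\<in>A. geo i) - (\<Prod>i\<in>A. geo i))"
proof -
  have *: "fps_nonneg (1 + (\<Sum>i\<in>A. fps_X ^ i) * (\<Prod>i\<in>A. geo i) - (\<Prod>i\<in>A. geo i))"
    using assms(1,2)
  proof (induction A rule: finite_induct)
    case (insert a A)
    let ?R = "\<Prod>i\<in>A. geo i" and ?S = "\<Sum>i\<in>A. fps_X ^ i :: int fps"
    have "0 < a"
      using insert.prems[of a] assms(3) by simp
    then have "geo a = 1 + fps_X ^ a * geo a"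
      using geo_inverse[of a] by (simp only: left_diff_distrib mult_1 diff_eq_eq)
    then have gR: "geo a * ?R = ?R + fps_X ^ a * geo a * ?R"
      by (metis distrib_right mult_1)
    have "1 + (fps_X ^ a + ?S) * (geo a * ?R) - geo a * ?R
        = 1 + ?S * (geo a * ?R) - (geo a * ?R - fps_X ^ a * geo a * ?R)"
      by (simp only: algebra_simps)
    also have "geo a * ?R - fps_X ^ a * geo a * ?R = ?R"
      by (subst gR) simp
    also have "1 + ?S * (geo a * ?R) - ?R = (1 + ?S * ?R - ?R) + ?S * (fps_X ^ a * geo a * ?R)"
      by (subst gR) (simp only: algebra_simps)
    finally have "1 + (fps_X ^ a + ?S) * (geo a * ?R) - geo a * ?R
        = (1 + ?S * ?R - ?R) + ?S * (fps_X ^ a * geo a * ?R)" .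
    moreover have "fps_nonneg ((1 + ?S * ?R - ?R) + ?S * (fps_X ^ a * geo a * ?R))"
      using insert.IH insert.prems
      by (intro fps_nonneg_add fps_nonneg_mult fps_nonneg_sum fps_nonneg_geo
          fps_nonneg_prod_geo fps_nonneg_power_X) auto
    ultimately have "fps_nonneg (1 + (fps_X ^ a + ?S) * (geo a * ?R) - geo a * ?R)"
      by (simp only:)
    then show ?case
      using insert.hyps by simp
  qed (simp add: fps_nonneg_def)
  have "fps_nonneg (fps_X ^ k * geo 1 - (\<Sum>i\<in>A. fps_X ^ i))"
    unfolding fps_nonneg_def
  proof
    fix n
    have "(\<Sum>i\<in>A. fps_X ^ i :: int fps) $ n = (if n \<in> A then 1 else 0)"
      by (simp add: fps_sum_nth assms(1))
    then show "0 \<le> (fps_X ^ k * geo 1 - (\<Sum>i\<in>A. fps_X ^ i)) $ n"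
      using assms(2)[of n] by (auto simp add: fps_X_power_mult_nth geo_def)
  qed
  then have "fps_nonneg ((fps_X ^ k * geo 1 - (\<Sum>i\<in>A. fps_X ^ i)) * (\<Prod>i\<in>A. geo i))"
    by (intro fps_nonneg_mult fps_nonneg_prod_geo)
  from fps_nonneg_add[OF * this] show ?thesis
    by (simp add: algebra_simps)
qed

text \<open>For L = 4, 5, 7, 8 the admissible forms 3u + c have u at most 1, and u = 1 leaves only T
  - 1 positive terms against T negative ones. Hence one factor \<open>geo c\<close> is combined
  exactly with the difference.\<close>

lemma G_nonneg_if_factor_certified:
  assumes "(fps_X ^ 3 * geo 3 - geo L) * geo c = denote s" "0 < L" "distinct (c # as)"
    "set (c # as) = {4..L+3}"
    and cert: "certified N (Plus (Over s as) (Plus (Sparse E) (Over (Sparse [(0, 1)]) [L])))"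
  shows "fps_nonneg (G L 3 + denote (Sparse E))"
proof -
  have "{3+1..3+L} = insert c (set as)" "c \<notin> set as"
    using assms(3,4) by auto
  then have "G L 3 = (fps_X ^ 3 * geo 3 - geo L) * (geo c * (\<Prod>i\<in>set as. geo i)) + geo L"
    using assms(2) by (simp only: G_eq zero_less_numeral prod.insert List.finite_set not_False_eq_True)
  also have "\<dots> = denote (Over s as) + geo L"
    using assms(3) by (simp only: denote_Over_distinct distinct.simps(2) assms(1)[symmetric] mult.assoc)
  finally show ?thesis
    using certified_nonneg[OF cert] by (simp add: add_ac)
qed

section \<open>Exact identities for L = 4, 5, 7, 8\<close>

lemma geo_multiple:
  assumes "0 < a" "0 < n"
  shows "geo a = (\<Sum>j<n. fps_X ^ (a * j)) * geo (a * n)"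
proof (rule geo_unique)
  show "(1 - fps_X ^ (a * n)) * geo a = (\<Sum>j<n. fps_X ^ (a * j))"
    using geo_expand[OF assms(1)] by (simp only: left_diff_distrib mult_1 diff_eq_eq)
qed (use assms in simp)

text \<open>The summand with two divisors in the next two lemmas grows without bound and eventually
  outweighs the bounded negative ones.\<close>

lemma factor_4:
  "(fps_X ^ 3 * geo 3 - geo 4) * geo 5 =
    denote (Plus (Plus (Over (Sparse [(3, 1), (4, -1)]) [12]) (Over (Sparse [(6, 1)]) [5, 12]))
      (Over (Sparse [(0, -1)]) [5]))"
proof -
  have "geo 3 = (1 + fps_X ^ 3 + fps_X ^ 6 + fps_X ^ 9) * geo 12"
    "geo 4 = (1 + fps_X ^ 4 + fps_X ^ 8) * geo 12"
    using geo_multiple[of 3 4] geo_multiple[of 4 3] by (simp_all add: eval_nat_numeral)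
  \<comment> \<open>Over the common denominator, x^3 pairs with -x^8, -x^4 with x^9 and -1 with
    x^12. Each pair cancels a divisor; only x^6 keeps both.\<close>
  moreover have "(x ^ 3 * ((1 + x ^ 3 + x ^ 6 + x ^ 9) * g) - (1 + x ^ 4 + x ^ 8) * g) * h
      = x ^ 3 * ((1 - x ^ 5) * h) * g - x ^ 4 * ((1 - x ^ 5) * h) * g
        + x ^ 6 * h * g - ((1 - x ^ 12) * g) * h" for x g h :: "int fps"
    by algebra
  ultimately have "(fps_X ^ 3 * geo 3 - geo 4) * geo 5
      = fps_X ^ 3 * ((1 - fps_X ^ 5) * geo 5) * geo 12 - fps_X ^ 4 * ((1 - fps_X ^ 5) * geo 5) * geo 12
        + fps_X ^ 6 * geo 5 * geo 12 - ((1 - fps_X ^ 12) * geo 12) * geo 5"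
    by (simp only:)
  also have "\<dots> = fps_X ^ 3 * geo 12 - fps_X ^ 4 * geo 12 + fps_X ^ 6 * geo 5 * geo 12 - geo 5"
    by (simp only: geo_inverse zero_less_numeral mult_1 mult_1_right)
  finally show ?thesis
    by (simp add: algebra_simps)
qed

lemma factor_5:
  "(fps_X ^ 3 * geo 3 - geo 5) * geo 4 =
    denote (Plus (Plus (Over (Sparse [(6, 1), (5, -1)]) [15]) (Over (Sparse [(3, 1), (12, 1)]) [4, 15]))
      (Over (Sparse [(0, -1)]) [4]))"
proof -
  have "geo 3 = (1 + fps_X ^ 3 + fps_X ^ 6 + fps_X ^ 9 + fps_X ^ 12) * geo 15"
    "geo 5 = (1 + fps_X ^ 5 + fps_X ^ 10) * geo 15"
    using geo_multiple[of 3 5] geo_multiple[of 5 3] by (simp_all add: eval_nat_numeral)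
  moreover have "(x ^ 3 * ((1 + x ^ 3 + x ^ 6 + x ^ 9 + x ^ 12) * g) - (1 + x ^ 5 + x ^ 10) * g) * h
      = x ^ 6 * ((1 - x ^ 4) * h) * g - x ^ 5 * ((1 - x ^ 4) * h) * g
        + (x ^ 3 + x ^ 12) * h * g - ((1 - x ^ 15) * g) * h" for x g h :: "int fps"
    by algebra
  ultimately have "(fps_X ^ 3 * geo 3 - geo 5) * geo 4
      = fps_X ^ 6 * ((1 - fps_X ^ 4) * geo 4) * geo 15 - fps_X ^ 5 * ((1 - fps_X ^ 4) * geo 4) * geo 15
        + (fps_X ^ 3 + fps_X ^ 12) * geo 4 * geo 15 - ((1 - fps_X ^ 15) * geo 15) * geo 4"
    by (simp only:)
  also have "\<dots> = fps_X ^ 6 * geo 15 - fps_X ^ 5 * geo 15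
      + (fps_X ^ 3 + fps_X ^ 12) * geo 4 * geo 15 - geo 4"
    by (simp only: geo_inverse zero_less_numeral mult_1 mult_1_right)
  finally show ?thesis
    by (simp add: algebra_simps)
qed

text \<open>Since q^3/(1 - q^3) = 1/(1 - q^3) - 1, this reduces to \<open>geo_diff_mult_geo\<close>
  with \<open>a = 3\<close>.\<close>

lemma factor_3_add:
  assumes "0 < c"
  shows "(fps_X ^ 3 * geo 3 - geo (3 + c)) * geo c =
    denote (Plus (Over (Sparse [(3, 1)]) [3, 3 + c]) (Over (Sparse [(0, -1)]) [c]))"
proof -
  have "(fps_X ^ 3 * geo 3 - geo (3 + c)) * geo c
      = (geo 3 - geo (3 + c)) * geo c - ((1 - fps_X ^ 3) * geo 3) * geo c"
    by (simp only: algebra_simps mult_1)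
  also have "\<dots> = fps_X ^ 3 * (geo 3 * geo (3 + c)) - geo c"
    using assms by (simp only: geo_inverse zero_less_numeral geo_diff_mult_geo mult_1)
  finally show ?thesis
    by (simp add: algebra_simps)
qed

lemmas factor_7 = factor_3_add[of 4, simplified add_numeral_left numeral_plus_numeral add_num_simps, OF zero_less_numeral]
  and factor_8 = factor_3_add[of 5, simplified add_numeral_left numeral_plus_numeral add_num_simps, OF zero_less_numeral]

section \<open>The range L >= 10\<close>

definition exceptions :: "(nat \<times> int) list" where
  "exceptions = [(4,1), (5,1), (8,1), (10,1), (12,1), (14,1), (16,1)]"

text \<open>Entries \<open>(L, u, c, T, a)\<close> with \<open>T\<close> terms kept of \<open>1/(1 - q\<^sup>L)\<close>. The first divisor
  \<open>1 - q\<^sup>a\<close> must make the coefficients eventually nonnegative by itself, which requires \<open>a\<close>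
  to spread the negative terms \<open>q\<^bsup>Lt\<^esup>\<close> over its residue classes.\<close>

definition truncation_data :: "(nat \<times> nat \<times> nat \<times> nat \<times> nat) list" where
  "truncation_data =
    [(10,2,4,4,7), (11,2,5,4,5), (12,4,0,2,5), (13,3,4,2,5), (14,3,5,2,5), (15,5,0,2,7), (16,4,4,2,5),
     (17,4,5,2,5), (18,6,0,2,5), (19,5,4,2,5), (20,5,5,2,7), (21,7,0,2,5), (22,6,4,2,5), (23,6,5,2,5)]"

lemma certified_10_to_23:
  "list_all (\<lambda>(L, u, c, T, a). L = 3 * u + c \<and> 0 < u \<and> (c = 0 \<or> 4 \<le> c) \<and> 0 < T \<and> 4 \<le> a \<and> a \<le> L + 3 \<and>
      certified 45
        (Plus (Over (truncation 3 (u * T) L T) (a # remove1 a [4..<L+4]))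
          (Plus (Sparse exceptions) (Over (Sparse [(0, 1)]) [L]))))
    truncation_data"
  by code_simp

lemma G_10_to_23:
  assumes "10 \<le> L" "L \<le> 23"
  shows "fps_nonneg (G L 3 + denote (Sparse exceptions))"
proof -
  have "L \<in> fst ` set truncation_data"
    using assms by (simp add: truncation_data_def) arith
  then obtain u c T a where "(L, u, c, T, a) \<in> set truncation_data"
    by fastforce
  from certified_10_to_23[unfolded list_all_iff, rule_format, OF this]
  show ?thesis
    unfolding prod.case by (elim conjE) (rule G_nonneg_if_certified)
qed

text \<open>With \<open>T = 1\<close> the truncation is q^3 + ... + q^18 - 1 for every L,
  represented by the argument 0. Writing E for the correction, the other summands are 1 + E and -(1
  + E) q^14/(1 - q).\<close>

lemma certified_ge_24:
  "certified 45 (Plus (Over (truncation 3 7 0 1) [4..<14]) (Plus (Sparse ((0, 1) # exceptions))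
    (Over (Sparse (map (\<lambda>(e, x). (e + 14, - x)) ((0, 1) # exceptions))) [1])))"
  by code_simp

lemma G_ge_24:
  assumes "24 \<le> L"
  shows "fps_nonneg (G L 3 + denote (Sparse exceptions))"
proof -
  define k where "k = L div 3"
  have k: "L = 3 * k + L mod 3" "8 \<le> k"
    using assms by (simp_all add: k_def)
  consider "L mod 3 = 0" | "L mod 3 = 1" | "L mod 3 = 2"
    by linarith
  \<comment> \<open>Remainders 1 and 2 are raised to 4 and 5 to make \<open>c\<close> a part in
    4..L+3. Then \<open>7 \<le> u\<close> permits cutting at \<open>J = 7\<close> with
    \<open>T = 1\<close>.\<close>
  then obtain u c where uc: "L = 3 * u + c" "7 \<le> u" "c = 0 \<or> 4 \<le> c"
  proof cases
    case 1
    then show thesis using k by (intro that[of k 0]) simp_all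
  next
    case 2
    then show thesis using k by (intro that[of "k - 1" 4]) simp_all
  next
    case 3
    then show thesis using k by (intro that[of "k - 1" 5]) simp_all
  qed
  let ?E = "denote (Sparse exceptions)" and ?Q = "denote (truncation 3 7 L 1)"
    and ?D = "fps_X ^ (3 * 7) * geo 3 - fps_X ^ (L * 1) * geo L"
    and ?P = "\<Prod>i\<in>{3+1..3+L}. geo i" and ?K = "\<Prod>i\<in>{4..<14}. geo i" and ?R = "\<Prod>i\<in>{14..L+3}. geo i"
    and ?t = "fps_X ^ 14 * geo 1"
  have "{3+1..3+L} = {4..<14} \<union> {14..L+3}"
    using assms by auto
  moreover have "(\<Prod>i\<in>{4..<14} \<union> {14..L+3}. geo i) = ?K * ?R"
    by (rule prod.union_disjoint) auto
  ultimately have P: "?P = ?K * ?R"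
    by (simp only:)
  have E: "fps_nonneg (1 + ?E)"
    by (simp add: fps_nonneg_def exceptions_def)
  have "denote (Over (truncation 3 7 0 1) [4..<14]) = ?Q * ?K"
    by (simp only: denote_Over_distinct distinct_upt set_upt) (simp add: truncation_def)
  moreover have "denote (Sparse ((0, 1) # exceptions)) = 1 + ?E"
    by simp
  moreover have "denote (Over (Sparse (map (\<lambda>(e, x). (e + 14, - x)) ((0, 1) # exceptions))) [1]) = - (1 + ?E) * ?t"
    by (simp add: exceptions_def algebra_simps power_add[symmetric])
  ultimately have "fps_nonneg (?Q * ?K + ((1 + ?E) + - (1 + ?E) * ?t))"
    using certified_nonneg[OF certified_ge_24] by (simp only: denote.simps(3))
  then have "fps_nonneg ((?Q * ?K + ((1 + ?E) + - (1 + ?E) * ?t)) * ?R)"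
    by (intro fps_nonneg_mult fps_nonneg_prod_geo)
  \<comment> \<open>Thus \<open>1 + ?E\<close> is at least \<open>(1 + ?E) * (1 - ?t) * ?R\<close>,
    which lets \<open>?R\<close> be factored out of the lower bound.\<close>
  moreover have "fps_nonneg ((1 + ?E) * (1 + ?t * ?R - ?R))"
    using E by (intro fps_nonneg_mult prod_geo_tail) auto
  moreover have "fps_nonneg (geo L - 1)"
    by (simp add: fps_nonneg_def geo_def)
  moreover have "fps_nonneg (?D * ?P)"
    using uc by (intro geo_remainder_nonneg[where u = u and c = c]) auto
  ultimately have "fps_nonneg (((?Q * ?K + ((1 + ?E) + - (1 + ?E) * ?t)) * ?R
      + (1 + ?E) * (1 + ?t * ?R - ?R)) + ((geo L - 1) + ?D * ?P))"
    by (intro fps_nonneg_add)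
  moreover have "((Q * K + ((1 + E) + - (1 + E) * t)) * R + (1 + E) * (1 + t * R - R)) + ((g - 1) + D * (K * R))
      = ((Q + D) * (K * R) + g) + E" for Q K E t R g D :: "int fps"
    by algebra
  ultimately have "fps_nonneg (((?Q + ?D) * ?P + geo L) + ?E)"
    by (simp only: P)
  also have "?Q + ?D = fps_X ^ 3 * geo 3 - geo L"
    using assms by (intro truncation_remainder[symmetric]) auto
  also have "(fps_X ^ 3 * geo 3 - geo L) * ?P + geo L = G L 3"
    using assms by (intro G_eq[symmetric]) auto
  finally show ?thesis .
qed

theorem theorem5:
  shows
    "(\<forall>L\<ge>10. fps_nonneg (G L 3 + fps_X^4 + fps_X^5 + fps_X^8 + fps_X^10 + fps_X^12 + fps_X^14
        + fps_X^16)) \<and>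
     fps_nonneg (G 9 3 + fps_X^4 + fps_X^5 + fps_X^8 + fps_X^10 + fps_X^12 + fps_X^14
        + 2 * fps_X^16) \<and>
     fps_nonneg (G 8 3 + fps_X^4 + fps_X^5 + fps_X^8 + fps_X^10 + fps_X^12 + fps_X^14
        + 2 * fps_X^16 + fps_X^20) \<and>
     fps_nonneg (G 7 3 + fps_X^4 + fps_X^5 + fps_X^8 + fps_X^10 + fps_X^12 + 2 * fps_X^14
        + fps_X^16 + fps_X^20) \<and>
     fps_nonneg (G 6 3 + fps_X^4 + fps_X^5 + fps_X^8 + fps_X^10 + fps_X^12 + fps_X^13
        + 2 * fps_X^14 + 2 * fps_X^16 + fps_X^18 + 2 * fps_X^20 + fps_X^22) \<and>
     fps_nonneg (G 5 3 + fps_X^4 + fps_X^5 + fps_X^8 + fps_X^10 + 2 * fps_X^12 + fps_X^13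
        + fps_X^14 + 2 * fps_X^16 + fps_X^17 + fps_X^18 + 3 * fps_X^20 + fps_X^22 + fps_X^24
        + fps_X^28) \<and>
     fps_nonneg (G 4 3 + fps_X^4 + fps_X^5 + fps_X^8 + fps_X^10 + fps_X^11 + 2 * fps_X^12
        + 2 * fps_X^14 + 3 * fps_X^16 + fps_X^17 + 2 * fps_X^18 + fps_X^19 + 4 * fps_X^20
        + 3 * fps_X^22 + fps_X^23 + 4 * fps_X^24 + fps_X^25 + 4 * fps_X^26 + 5 * fps_X^28
        + fps_X^29 + 3 * fps_X^30 + 6 * fps_X^32 + 3 * fps_X^34 + 4 * fps_X^36 + 2 * fps_X^38
        + 4 * fps_X^40 + 2 * fps_X^44)"
proof (intro conjI allI impI)
  fix L :: nat assume "10 \<le> L"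
  then have "fps_nonneg (G L 3 + denote (Sparse exceptions))"
    using G_10_to_23[of L] G_ge_24[of L] by linarith
  then show "fps_nonneg (G L 3 + fps_X^4 + fps_X^5 + fps_X^8 + fps_X^10 + fps_X^12 + fps_X^14
        + fps_X^16)"
    by (simp add: exceptions_def add.assoc)
next
  have "fps_nonneg (G 9 3 + denote (Sparse [(4,1), (5,1), (8,1), (10,1), (12,1), (14,1), (16,2)]))"
    \<comment> \<open>The negative exponents 0, 9, 18, 27 are distinct modulo 5, and each class
      contains some of 3, 6, ..., 33.\<close>
    by (rule G_nonneg_if_certified[where u = 3 and c = 0 and T = 4 and a = 5 and N = 45])
      (simp_all, code_simp)
  then show "fps_nonneg (G 9 3 + fps_X^4 + fps_X^5 + fps_X^8 + fps_X^10 + fps_X^12 + fps_X^14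
        + 2 * fps_X^16)"
    by (simp add: add.assoc)
next
  have "fps_nonneg (G 8 3
      + denote (Sparse [(4,1), (5,1), (8,1), (10,1), (12,1), (14,1), (16,2), (20,1)]))"
    \<comment> \<open>The part 5 is used up by \<open>factor_8\<close>; the other parts of 4..11
      remain as divisors.\<close>
    by (rule G_nonneg_if_factor_certified[OF factor_8, where as = "[4,6,7,8,9,10,11]" and N = 32])
      (simp, simp, fastforce, code_simp)
  then show "fps_nonneg (G 8 3 + fps_X^4 + fps_X^5 + fps_X^8 + fps_X^10 + fps_X^12 + fps_X^14
        + 2 * fps_X^16 + fps_X^20)"
    by (simp add: add.assoc)
next
  have "fps_nonneg (G 7 3
      + denote (Sparse [(4,1), (5,1), (8,1), (10,1), (12,1), (14,2), (16,1), (20,1)]))"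
    by (rule G_nonneg_if_factor_certified[OF factor_7, where as = "[5,6,7,8,9,10]" and N = 31])
      (simp, simp, fastforce, code_simp)
  then show "fps_nonneg (G 7 3 + fps_X^4 + fps_X^5 + fps_X^8 + fps_X^10 + fps_X^12 + 2 * fps_X^14
        + fps_X^16 + fps_X^20)"
    by (simp add: add.assoc)
next
  have "fps_nonneg (G 6 3 + denote (Sparse [(4,1), (5,1), (8,1), (10,1), (12,1), (13,1), (14,2), (16,2), (18,1), (20,2), (22,1)]))"
    by (rule G_nonneg_if_certified[where u = 2 and c = 0 and T = 4 and a = 5 and N = 45])
      (simp_all, code_simp)
  then show "fps_nonneg (G 6 3 + fps_X^4 + fps_X^5 + fps_X^8 + fps_X^10 + fps_X^12 + fps_X^13
        + 2 * fps_X^14 + 2 * fps_X^16 + fps_X^18 + 2 * fps_X^20 + fps_X^22)"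
    by (simp add: add.assoc)
next
  have "fps_nonneg (G 5 3
      + denote (Sparse [(4,1), (5,1), (8,1), (10,1), (12,2), (13,1), (14,1), (16,2), (17,1), (18,1), (20,3), (22,1), (24,1), (28,1)]))"
    by (rule G_nonneg_if_factor_certified[OF factor_5, where as = "[5,6,7,8]" and N = 69])
      (simp, simp, fastforce, code_simp)
  then show "fps_nonneg (G 5 3 + fps_X^4 + fps_X^5 + fps_X^8 + fps_X^10 + 2 * fps_X^12 + fps_X^13
        + fps_X^14 + 2 * fps_X^16 + fps_X^17 + fps_X^18 + 3 * fps_X^20 + fps_X^22 + fps_X^24
        + fps_X^28)"
    by (simp add: add.assoc)
next
  have "fps_nonneg (G 4 3
      + denote (Sparse [(4,1), (5,1), (8,1), (10,1), (11,1), (12,2), (14,2), (16,3), (17,1), (18,2), (19,1), (20,4), (22,3), (23,1), (24,4), (25,1), (26,4), (28,5), (29,1), (30,3), (32,6), (34,3), (36,4), (38,2), (40,4), (44,2)]))"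
    by (rule G_nonneg_if_factor_certified[OF factor_4, where as = "[4,6,7]" and N = 122])
      (simp, simp, fastforce, code_simp)
  then show "fps_nonneg (G 4 3 + fps_X^4 + fps_X^5 + fps_X^8 + fps_X^10 + fps_X^11 + 2 * fps_X^12
        + 2 * fps_X^14 + 3 * fps_X^16 + fps_X^17 + 2 * fps_X^18 + fps_X^19 + 4 * fps_X^20
        + 3 * fps_X^22 + fps_X^23 + 4 * fps_X^24 + fps_X^25 + 4 * fps_X^26 + 5 * fps_X^28
        + fps_X^29 + 3 * fps_X^30 + 6 * fps_X^32 + 3 * fps_X^34 + 4 * fps_X^36 + 2 * fps_X^38
        + 4 * fps_X^40 + 2 * fps_X^44)"
    by (simp add: add.assoc)
qed

end
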